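(* Let $p(x,y)+i\,q(x,y)$ be a holomorphic function such that $\Vert\nabla p(x,y)\Vert>0$ on an open domain $\Omega\subset\mathbb{R}^2$. Consider the one parameter family $\{C_\alpha\}_{\alpha\in\mathbb{R}}$ of the level curves of the harmonic functions: $$C_\alpha=\{(x,y)\in\Omega\subset\mathbb{R}^2 : (\sin\alpha)\,p(x,y)+(\cos\alpha)\,q(x,y)=0\}.$$ Assume that the $\mathcal{C}^1$ parameterized curve $\mathbf{X}_*$ connecting from $(x_1,y_1)\in C_\alpha$ to $(x_2,y_2)\in C_\alpha$ lies in the level curve $C_\alpha$. For any $\mathcal{C}^1$ parameterized curve $\mathbf{X}\subset\Omega$ connecting from $(x_1,y_1)$ to $(x_2,y_2)$, we have $$\int_{\mathbf{X}}\Vert\nabla p(x,y)\Vert\,ds\;\ge\;\int_{\mathbf{X}_*}\Vert\nabla p(x,y)\Vert\,ds .$$ In other words, the curve $\mathbf{X}_*$ becomes a weighted length-minimizer with respect to the density $\Vert\nabla p(x,y)\Vert$.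
   Context: The plane $\mathbb{R}^2$ is identified with $\mathbb{C}$ via $z=x+iy$, and $p$, $q$ are the real and imaginary parts (real-valued functions) of the holomorphic function on $\Omega$. $\nabla$ and $\Vert\cdot\Vert$ are the Euclidean gradient and norm, and $ds$ is the Euclidean arc-length element. The integral $\int_\gamma \Vert\nabla p\Vert\,ds$ is the weighted length of a curve $\gamma$ with respect to the density $\Vert\nabla p\Vert$.
   Formalization: The curve X_* is additionally assumed to be regular (nowhere vanishing velocity) or injective; without this a C^1 curve X_* that backtracks along the level curve, such as sin(3πt/2) on the real axis for f(z)=z, is longer than the straight segment. *)

theory Defs
  imports "HOL-Analysis.Analysis"
begin

definition gradient :: "('a::real_inner \<Rightarrow> real) \<Rightarrow> 'a \<Rightarrow> 'a" where
  "gradient f z = (THE D. GDERIV f z :> D)"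

definition level_curve ::
    "(complex \<Rightarrow> real) \<Rightarrow> (complex \<Rightarrow> real) \<Rightarrow> complex set \<Rightarrow> real \<Rightarrow> complex set" where
  "level_curve p q \<Omega> \<alpha> = {z \<in> \<Omega>. sin \<alpha> * p z + cos \<alpha> * q z = 0}"

text \<open>
  The derivative is taken within the parameter interval, hence one-sided at its
  endpoints: nothing is required of \<open>X\<close> outside \<open>{a..b}\<close>. The velocity may vanish.
\<close>

definition C1_curve ::
    "real \<Rightarrow> real \<Rightarrow> (real \<Rightarrow> 'a::real_normed_vector) \<Rightarrow> 'a \<Rightarrow> 'a \<Rightarrow> bool" where
  "C1_curve a b X z w \<longleftrightarrow>
     a < b \<and> X a = z \<and> X b = w \<and>
     (\<exists>X'. continuous_on {a..b} X' \<and>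
       (\<forall>t\<in>{a..b}. (X has_vector_derivative X' t) (at t within {a..b})))"

definition regular_curve ::
    "real \<Rightarrow> real \<Rightarrow> (real \<Rightarrow> 'a::real_normed_vector) \<Rightarrow> bool" where
  "regular_curve a b X \<longleftrightarrow>
     (\<forall>t\<in>{a..b}. vector_derivative X (at t within {a..b}) \<noteq> 0)"

definition weighted_length ::
    "('a::real_normed_vector \<Rightarrow> real) \<Rightarrow> real \<Rightarrow> real \<Rightarrow> (real \<Rightarrow> 'a) \<Rightarrow> real" where
  "weighted_length \<rho> a b X =
     integral {a..b} (\<lambda>t. \<rho> (X t) * norm (vector_derivative X (at t within {a..b})))"

end

theory Submission
  imports Defs "HOL-Complex_Analysis.Conformal_Mappings"
begin

text \<open>
  Write \<open>f = p + \<i> q\<close>. By the Cauchy-Riemann equations \<open>\<parallel>\<nabla>p\<parallel> = \<bar>f'\<bar>\<close>, so the weighted length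
  of a curve \<open>X\<close> is the Euclidean length of the image curve \<open>f \<circ> X\<close>. In particular it is at
  least \<open>\<bar>f z\<^sub>2 - f z\<^sub>1\<bar>\<close>, whatever curve joins \<open>z\<^sub>1\<close> to \<open>z\<^sub>2\<close>.

  It remains to see that a curve in \<open>C\<^sub>\<alpha>\<close> attains this bound. The rotated function
  \<open>g = exp (\<i> \<alpha>) f\<close> has imaginary part \<open>sin \<alpha> p + cos \<alpha> q\<close>, so \<open>g\<close> maps \<open>C\<^sub>\<alpha>\<close> into the real axis
  and \<open>h = g \<circ> X\<^sub>0\<close> is a real \<open>C\<^sup>1\<close> function. The length of \<open>h\<close> is \<open>\<bar>h b - h a\<bar>\<close> as soon as \<open>h\<close> does
  not turn back, that is, as soon as \<open>h\<close> is injective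
  (\<open>integral_abs_deriv_of_injective\<close>). If \<open>X\<^sub>0\<close> is regular, \<open>h' \<noteq> 0\<close> and Rolle's theorem gives
  injectivity. If \<open>X\<^sub>0\<close> is merely injective, \<open>h\<close> is locally injective because \<open>g\<close> is a local
  homeomorphism, and on an interval this already implies injectivity
  (\<open>locally_injective_imp_injective\<close>).
\<close>

section \<open>The density as the modulus of a complex derivative\<close>

text \<open>
  The real-linear map \<open>v \<mapsto> Re (D v)\<close> is the inner product with the conjugate of \<open>D\<close>.
\<close>

lemma gradient_Re:
  assumes "(f has_field_derivative D) (at z)"
  shows "gradient (\<lambda>z. Re (f z)) z = cnj D"
proof -
  have "(f has_derivative (*) D) (at z)"
    using assms by (simp add: has_field_derivative_def)
  then have "((\<lambda>z. Re (f z)) has_derivative (\<lambda>v. Re (D * v))) (at z)"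
    by (rule has_derivative_Re)
  moreover have "(\<lambda>v. Re (D * v)) = (\<lambda>v. inner v (cnj D))"
    by (auto simp: inner_complex_def algebra_simps)
  ultimately have D: "GDERIV (\<lambda>z. Re (f z)) z :> cnj D"
    by (simp add: gderiv_def)
  have "E = cnj D" if "GDERIV (\<lambda>z. Re (f z)) z :> E" for E
  proof -
    have "(\<lambda>v. inner v E) = (\<lambda>v. inner v (cnj D))"
      using that D unfolding gderiv_def by (rule has_derivative_unique)
    then show ?thesis
      by (metis vector_eq_ldot)
  qed
  with D show ?thesis
    unfolding gradient_def by (rule the_equality)
qed

lemma C1_curve_vector_derivative:
  assumes "C1_curve a b X z w"
  defines "V \<equiv> \<lambda>t. vector_derivative X (at t within {a..b})"
  shows "continuous_on {a..b} V"
    and "\<And>t. t \<in> {a..b} \<Longrightarrow> (X has_vector_derivative V t) (at t within {a..b})"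
proof -
  obtain X' where "a < b" and cont: "continuous_on {a..b} X'"
    and der: "\<And>t. t \<in> {a..b} \<Longrightarrow> (X has_vector_derivative X' t) (at t within {a..b})"
    using assms(1) by (auto simp: C1_curve_def)
  have eq: "V t = X' t" if "t \<in> {a..b}" for t
    unfolding V_def using vector_derivative_within_cbox[of a b t X "X' t"] der \<open>a < b\<close> that
    by auto
  show "continuous_on {a..b} V"
    using cont by (rule continuous_on_eq) (simp add: eq)
  show "(X has_vector_derivative V t) (at t within {a..b})" if "t \<in> {a..b}" for t
    using der[OF that] by (simp add: eq[OF that])
qed

lemma holomorphic_image_of_C1_curve:
  assumes "g holomorphic_on \<Omega>" "open \<Omega>" "C1_curve a b X z w" "X ` {a..b} \<subseteq> \<Omega>"
  defines "V \<equiv> \<lambda>t. vector_derivative X (at t within {a..b})"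
  shows "continuous_on {a..b} (\<lambda>t. deriv g (X t) * V t)"
    and "\<And>t. t \<in> {a..b} \<Longrightarrow>
           ((\<lambda>t. g (X t)) has_vector_derivative deriv g (X t) * V t) (at t within {a..b})"
proof -
  have V: "continuous_on {a..b} V"
    "\<And>t. t \<in> {a..b} \<Longrightarrow> (X has_vector_derivative V t) (at t within {a..b})"
    using C1_curve_vector_derivative[OF assms(3)] by (simp_all add: V_def)
  have contX: "continuous_on {a..b} X"
    using V(2) by (rule continuous_on_vector_derivative)
  have "continuous_on \<Omega> (deriv g)"
    using assms(1,2) by (intro holomorphic_on_imp_continuous_on holomorphic_deriv)
  then have "continuous_on {a..b} (\<lambda>t. deriv g (X t))"
    using contX assms(4) by (rule continuous_on_compose2)
  then show "continuous_on {a..b} (\<lambda>t. deriv g (X t) * V t)"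
    using V(1) by (rule continuous_on_mult)
  show "((\<lambda>t. g (X t)) has_vector_derivative deriv g (X t) * V t) (at t within {a..b})"
    if t: "t \<in> {a..b}" for t
  proof -
    have "(g has_field_derivative deriv g (X t)) (at (X t) within X ` {a..b})"
      using assms t by (intro holomorphic_derivI[of _ \<Omega>]) auto
    then have "(g \<circ> X has_vector_derivative V t * deriv g (X t)) (at t within {a..b})"
      using field_vector_diff_chain_within[OF V(2)[OF t]] by blast
    then show ?thesis
      by (simp add: o_def mult.commute)
  qed
qed

section \<open>Lengths of curves with given endpoints\<close>

lemma norm_diff_le_integral_norm_deriv:
  fixes F :: "real \<Rightarrow> 'a::euclidean_space"
  assumes "a \<le> b" and cont: "continuous_on {a..b} F'"
    and "\<And>t. t \<in> {a..b} \<Longrightarrow> (F has_vector_derivative F' t) (at t within {a..b})"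
  shows "norm (F b - F a) \<le> integral {a..b} (\<lambda>t. norm (F' t))"
proof -
  have "(F' has_integral F b - F a) {a..b}"
    using assms(1,3) by (rule fundamental_theorem_of_calculus)
  moreover have "norm (integral {a..b} F') \<le> integral {a..b} (\<lambda>t. norm (F' t))"
    using cont by (intro integral_norm_bound_integral integrable_continuous_real
        continuous_intros) auto
  ultimately show ?thesis
    by (simp add: integral_unique)
qed

lemma mono_on_imp_derivative_within_nonneg:
  fixes h :: "real \<Rightarrow> real"
  assumes "mono_on {a..b} h" "a < b" "t \<in> {a..b}"
    and der: "(h has_real_derivative D) (at t within {a..b})"
  shows "0 \<le> D"
proof (rule tendsto_lowerbound)
  show "((\<lambda>s. (h s - h t) / (s - t)) \<longlongrightarrow> D) (at t within {a..b})"
    using der by (simp add: has_field_derivative_iff)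
  show "eventually (\<lambda>s. 0 \<le> (h s - h t) / (s - t)) (at t within {a..b})"
    unfolding eventually_at_filter
  proof (intro always_eventually allI impI)
    fix s assume "s \<noteq> t" "s \<in> {a..b}"
    then show "0 \<le> (h s - h t) / (s - t)"
      using assms(1,3) by (cases "s < t")
        (auto simp: mono_on_def intro: divide_nonneg_nonneg divide_nonpos_nonpos)
  qed
  show "at t within {a..b} \<noteq> bot"
    using assms(2,3) by (simp add: trivial_limit_within islimpt_Icc)
qed

text \<open>
  A continuous injective function on an interval is monotone, so its derivative has constant
  sign and the absolute value can be moved outside the integral.
\<close>

lemma integral_abs_deriv_of_injective:
  fixes h :: "real \<Rightarrow> real"
  assumes "a < b" and inj: "inj_on h {a..b}"
    and der: "\<And>t. t \<in> {a..b} \<Longrightarrow> (h has_real_derivative h' t) (at t within {a..b})"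
  shows "integral {a..b} (\<lambda>t. \<bar>h' t\<bar>) = \<bar>h b - h a\<bar>"
proof -
  have increasing: "integral {a..b} (\<lambda>t. \<bar>k' t\<bar>) = \<bar>k b - k a\<bar>"
    if "mono_on {a..b} k"
      and k: "\<And>t. t \<in> {a..b} \<Longrightarrow> (k has_real_derivative k' t) (at t within {a..b})"
    for k k' :: "real \<Rightarrow> real"
  proof -
    have "integral {a..b} (\<lambda>t. \<bar>k' t\<bar>) = integral {a..b} k'"
      using mono_on_imp_derivative_within_nonneg[OF that(1) \<open>a < b\<close> _ k]
      by (intro integral_cong) simp
    also have "\<dots> = k b - k a"
      using \<open>a < b\<close> k by (intro integral_unique fundamental_theorem_of_calculus)
        (auto simp: has_real_derivative_iff_has_vector_derivative)
    also have "\<dots> = \<bar>k b - k a\<bar>"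
      using that(1) \<open>a < b\<close> by (auto simp: mono_on_def)
    finally show ?thesis .
  qed
  have "continuous_on {a..b} h"
    using der by (rule DERIV_continuous_on)
  then consider "strict_mono_on {a..b} h" | "strict_antimono_on {a..b} h"
    using inj injective_eq_monotone_map[of "{a..b}" h] by (auto simp: is_interval_cc)
  then show ?thesis
  proof cases
    case 1
    then show ?thesis
      using increasing[OF strict_mono_on_imp_mono_on der] by blast
  next
    case 2
    have "mono_on {a..b} (\<lambda>t. - h t)"
      using 2 by (fastforce simp: monotone_on_def mono_on_def order.order_iff_strict)
    then show ?thesis
      using increasing[of "\<lambda>t. - h t" "\<lambda>t. - h' t"] der
      by (simp add: DERIV_minus abs_minus_commute)
  qed
qed

section \<open>Curves that do not turn back on the real line\<close>

text \<open>
  If \<open>h\<close> took the same value at both ends of some interval, it would have an interior extremum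
  there, but a continuous function that is injective near a point is strictly monotone near it.
\<close>

lemma locally_injective_imp_injective:
  fixes h :: "real \<Rightarrow> real"
  assumes cont: "continuous_on {a..b} h"
    and loc: "\<And>u. u \<in> {a..b} \<Longrightarrow> \<exists>e>0. inj_on h ({a..b} \<inter> ball u e)"
  shows "inj_on h {a..b}"
proof (rule linorder_inj_onI')
  fix s t assume st: "s < t" "s \<in> {a..b}" "t \<in> {a..b}"
  show "h s \<noteq> h t"
  proof
    assume eq: "h s = h t"
    have cst: "continuous_on {s..t} h"
      using cont st by (auto elim: continuous_on_subset)
    have no_extremum: False
      if u: "s < u" "u < t"
        and ext: "(\<forall>x\<in>{s..t}. h x \<le> h u) \<or> (\<forall>x\<in>{s..t}. h u \<le> h x)" for u
    proof -
      obtain e where "e > 0" and e: "inj_on h ({a..b} \<inter> ball u e)"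
        using loc[of u] u st by auto
      define l r where "l = max s (u - e/2)" and "r = min t (u + e/2)"
      have lr: "l < u" "u < r" "s \<le> l" "r \<le> t"
        using u \<open>e > 0\<close> by (auto simp: l_def r_def)
      have "{l..r} \<subseteq> {a..b} \<inter> ball u e"
        using st \<open>e > 0\<close> by (auto simp: l_def r_def dist_real_def)
      then have "inj_on h {l..r}"
        using e by (rule inj_on_subset[rotated])
      moreover have "continuous_on {l..r} h"
        using cst lr by (auto elim: continuous_on_subset)
      ultimately have "h l < h u \<and> h u < h r \<or> h l > h u \<and> h u > h r"
        using continuous_inj_imp_mono[of l u r h] lr by blast
      moreover have "l \<in> {s..t}" "r \<in> {s..t}"
        using lr u by auto
      ultimately show False
        using ext by force
    qed
    obtain m where m: "m \<in> {s..t}" "\<forall>x\<in>{s..t}. h m \<le> h x"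
      using continuous_attains_inf[of "{s..t}" h] cst st by auto
    obtain M where M: "M \<in> {s..t}" "\<forall>x\<in>{s..t}. h x \<le> h M"
      using continuous_attains_sup[of "{s..t}" h] cst st by auto
    consider "s < m" "m < t" | "s < M" "M < t" | "m \<in> {s, t}" "M \<in> {s, t}"
      using m(1) M(1) by force
    then show False
    proof cases
      case 1
      then show False using no_extremum[of m] m(2) by blast
    next
      case 2
      then show False using no_extremum[of M] M(2) by blast
    next
      case 3
      \<comment> \<open>Both extrema lie at the ends, so \<open>h\<close> is constant and any interior point is an extremum.\<close>
      then have "h M = h m"
        using eq by auto
      also have "h m \<le> h ((s + t) / 2)"
        using m(2) st(1) by simp
      finally have "\<forall>x\<in>{s..t}. h x \<le> h ((s + t) / 2)"
        using M(2) by (meson order_trans)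
      then show False
        using no_extremum[of "(s + t) / 2"] st(1) by simp
    qed
  qed
qed

text \<open>
  A curve that is neither regular nor injective may stop and run back, and so may its real
  image \<open>h\<close>. Either property passes from \<open>X\<close> to \<open>h\<close> because \<open>g'\<close> has no zeros: a nonzero
  velocity stays nonzero, and injectivity survives near each parameter.
\<close>

lemma real_image_of_curve_injective:
  assumes hol: "g holomorphic_on \<Omega>" and "open \<Omega>"
    and g'0: "\<And>z. z \<in> \<Omega> \<Longrightarrow> deriv g z \<noteq> 0"
    and X: "C1_curve a b X z w" "X ` {a..b} \<subseteq> \<Omega>"
    and real: "\<And>t. t \<in> {a..b} \<Longrightarrow> g (X t) = of_real (h t)"
    and der: "\<And>t. t \<in> {a..b} \<Longrightarrow> (h has_real_derivative h' t) (at t within {a..b})"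
    and h': "\<And>t. t \<in> {a..b} \<Longrightarrow>
      of_real (h' t) = deriv g (X t) * vector_derivative X (at t within {a..b})"
    and simple: "regular_curve a b X \<or> inj_on X {a..b}"
  shows "inj_on h {a..b}"
  using simple
proof
  assume "regular_curve a b X"
  then have h'0: "h' t \<noteq> 0" if "t \<in> {a..b}" for t
  proof -
    have "X t \<in> \<Omega>"
      using X(2) that by blast
    then have "of_real (h' t) \<noteq> (0::complex)"
      using h'[OF that] g'0 \<open>regular_curve a b X\<close> that by (simp add: regular_curve_def)
    then show ?thesis
      by simp
  qed
  show ?thesis
  proof (rule linorder_inj_onI')
    fix s t assume st: "s < t" "s \<in> {a..b}" "t \<in> {a..b}"
    show "h s \<noteq> h t"
    proof
      assume "h s = h t"
      have "continuous_on {s..t} h"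
        using DERIV_continuous_on[OF der] st by (auto elim: continuous_on_subset)
      moreover have inner: "(h has_real_derivative h' u) (at u)" if "s < u" "u < t" for u
        using der[of u] at_within_Icc_at[of a u b] st that by auto
      ultimately obtain u where u: "s < u" "u < t" "(h has_real_derivative 0) (at u)"
        using Rolle[of s t h] \<open>h s = h t\<close> st(1) real_differentiable_def by blast
      then have "h' u = 0"
        using inner DERIV_unique by blast
      then show False
        using h'0[of u] u st by auto
    qed
  qed
next
  assume injX: "inj_on X {a..b}"
  have contX: "continuous_on {a..b} X"
    using C1_curve_vector_derivative(2)[OF X(1)] by (rule continuous_on_vector_derivative)
  show ?thesis
  proof (rule locally_injective_imp_injective)
    show "continuous_on {a..b} h"
      using der by (rule DERIV_continuous_on)
    fix u assume u: "u \<in> {a..b}"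
    have "X u \<in> \<Omega>"
      using X(2) u by auto
    then obtain r where "r > 0" and r: "inj_on g (ball (X u) r)"
      using has_complex_derivative_locally_injective[OF hol _ \<open>open \<Omega>\<close> g'0] by blast
    obtain e where "e > 0" and e: "\<And>t. t \<in> {a..b} \<Longrightarrow> dist t u < e \<Longrightarrow> dist (X t) (X u) < r"
      using contX u \<open>r > 0\<close> unfolding continuous_on_iff by meson
    have "inj_on h ({a..b} \<inter> ball u e)"
    proof (rule inj_onI)
      fix s t assume s: "s \<in> {a..b} \<inter> ball u e" and t: "t \<in> {a..b} \<inter> ball u e" and "h s = h t"
      then have "g (X s) = g (X t)"
        by (simp add: real)
      then have "X s = X t"
        using r e[of s] e[of t] s t by (auto simp: inj_on_def dist_commute)
      then show "s = t"
        using injX s t by (auto simp: inj_on_def)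
    qed
    then show "\<exists>e>0. inj_on h ({a..b} \<inter> ball u e)"
      using \<open>e > 0\<close> by blast
  qed
qed

section \<open>Minimality of level curves\<close>

theorem corollary3:
  fixes p q :: "complex \<Rightarrow> real"
    and \<Omega> :: "complex set"
    and \<alpha> a b c d :: real
    and z\<^sub>1 z\<^sub>2 :: complex
    and X\<^sub>0 X :: "real \<Rightarrow> complex"
  assumes "open \<Omega>" and "connected \<Omega>"
    and "(\<lambda>z. of_real (p z) + \<i> * of_real (q z)) holomorphic_on \<Omega>"
    and "\<And>z. z \<in> \<Omega> \<Longrightarrow> norm (gradient p z) > 0"
    and "z\<^sub>1 \<in> level_curve p q \<Omega> \<alpha>" and "z\<^sub>2 \<in> level_curve p q \<Omega> \<alpha>"
    and "C1_curve a b X\<^sub>0 z\<^sub>1 z\<^sub>2"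
    and "regular_curve a b X\<^sub>0 \<or> inj_on X\<^sub>0 {a..b}"
    and "X\<^sub>0 ` {a..b} \<subseteq> level_curve p q \<Omega> \<alpha>"
    and "C1_curve c d X z\<^sub>1 z\<^sub>2"
    and "X ` {c..d} \<subseteq> \<Omega>"
  shows "weighted_length (\<lambda>z. norm (gradient p z)) c d X
           \<ge> weighted_length (\<lambda>z. norm (gradient p z)) a b X\<^sub>0"
proof -
  define f where "f = (\<lambda>z. of_real (p z) + \<i> * of_real (q z))"
  \<comment> \<open>The rotation by \<open>\<alpha>\<close> turns the level curve into the preimage of the real axis.\<close>
  define g where "g = (\<lambda>z. cis \<alpha> * f z)"
  have f: "f holomorphic_on \<Omega>"
    using assms(3) by (simp add: f_def)
  then have g: "g holomorphic_on \<Omega>"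
    unfolding g_def by (intro holomorphic_intros)
  have density: "norm (gradient p z) = norm (deriv g z)" if "z \<in> \<Omega>" for z
  proof -
    have f': "(f has_field_derivative deriv f z) (at z)"
      using f \<open>open \<Omega>\<close> that by (rule holomorphic_derivI)
    then have "(g has_field_derivative cis \<alpha> * deriv f z) (at z)"
      unfolding g_def by (rule DERIV_cmult)
    then have "deriv g z = cis \<alpha> * deriv f z"
      by (rule DERIV_imp_deriv)
    moreover have "gradient p z = cnj (deriv f z)"
      using gradient_Re[OF f'] by (simp add: f_def)
    ultimately show ?thesis
      by (simp add: norm_mult)
  qed
  have length: "weighted_length (\<lambda>z. norm (gradient p z)) s t Y =
      integral {s..t} (\<lambda>u. norm (deriv g (Y u) * vector_derivative Y (at u within {s..t})))"
    if "Y ` {s..t} \<subseteq> \<Omega>" for s t Y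
    unfolding weighted_length_def
  proof (rule integral_cong)
    fix u assume "u \<in> {s..t}"
    then have "Y u \<in> \<Omega>"
      using that by blast
    then show "norm (gradient p (Y u)) * norm (vector_derivative Y (at u within {s..t}))
        = norm (deriv g (Y u) * vector_derivative Y (at u within {s..t}))"
      by (simp add: density norm_mult)
  qed

  have X: "c < d" "X c = z\<^sub>1" "X d = z\<^sub>2" and X0: "a < b" "X\<^sub>0 a = z\<^sub>1" "X\<^sub>0 b = z\<^sub>2"
    using assms(7,10) by (auto simp: C1_curve_def)
  have X0_\<Omega>: "X\<^sub>0 ` {a..b} \<subseteq> \<Omega>"
    using assms(9) by (auto simp: level_curve_def)

  define G' where "G' = (\<lambda>t. deriv g (X\<^sub>0 t) * vector_derivative X\<^sub>0 (at t within {a..b}))"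
  define h where "h = (\<lambda>t. Re (g (X\<^sub>0 t)))"
  have G': "((\<lambda>t. g (X\<^sub>0 t)) has_vector_derivative G' t) (at t within {a..b})"
    if "t \<in> {a..b}" for t
    unfolding G'_def
    using holomorphic_image_of_C1_curve(2)[OF g \<open>open \<Omega>\<close> assms(7) X0_\<Omega> that] .
  have Im0: "Im (g (X\<^sub>0 t)) = 0" if "t \<in> {a..b}" for t
  proof -
    have "X\<^sub>0 t \<in> level_curve p q \<Omega> \<alpha>"
      using assms(9) that by blast
    moreover have "Im (g z) = sin \<alpha> * p z + cos \<alpha> * q z" for z
      by (simp add: g_def f_def)
    ultimately show ?thesis
      by (simp only: level_curve_def mem_Collect_eq)
  qed
  then have real: "g (X\<^sub>0 t) = of_real (h t)" if "t \<in> {a..b}" for t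
    using that by (simp add: h_def complex_eq_iff)
  have Im_G': "Im (G' t) = 0" if "t \<in> {a..b}" for t
  proof -
    have "((\<lambda>t. Im (g (X\<^sub>0 t))) has_vector_derivative Im (G' t)) (at t within {a..b})"
      using G'[OF that] by (rule bounded_linear.has_vector_derivative[OF bounded_linear_Im])
    then have "((\<lambda>t. 0) has_vector_derivative Im (G' t)) (at t within {a..b})"
      using that by (rule has_vector_derivative_transform[rotated 2]) (simp add: Im0)
    moreover have "at t within {a..b} \<noteq> bot"
      using X0(1) that by (simp add: trivial_limit_within islimpt_Icc)
    ultimately show ?thesis
      using vector_derivative_unique_within has_vector_derivative_const by blast
  qed
  have h': "(h has_real_derivative Re (G' t)) (at t within {a..b})" if "t \<in> {a..b}" for t
    unfolding h_def has_real_derivative_iff_has_vector_derivative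
    using G'[OF that] by (rule bounded_linear.has_vector_derivative[OF bounded_linear_Re])
  have G'_real: "of_real (Re (G' t)) = G' t" if "t \<in> {a..b}" for t
    using Im_G'[OF that] by (simp add: complex_eq_iff)
  have "deriv g z \<noteq> 0" if "z \<in> \<Omega>" for z
    using density[OF that] assms(4)[OF that] by auto
  then have "inj_on h {a..b}"
    using real_image_of_curve_injective[OF g \<open>open \<Omega>\<close> _ assms(7) X0_\<Omega> real h' _ assms(8)]
      G'_real by (simp add: G'_def)

  then have "integral {a..b} (\<lambda>t. \<bar>Re (G' t)\<bar>) = \<bar>h b - h a\<bar>"
    using X0(1) h' by (intro integral_abs_deriv_of_injective)
  moreover have "weighted_length (\<lambda>z. norm (gradient p z)) a b X\<^sub>0
      = integral {a..b} (\<lambda>t. \<bar>Re (G' t)\<bar>)"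
    unfolding length[OF X0_\<Omega>]
  proof (rule integral_cong)
    fix t assume "t \<in> {a..b}"
    then have "norm (G' t) = \<bar>Re (G' t)\<bar>"
      using norm_of_real[of "Re (G' t)", where 'a = complex] by (simp only: G'_real)
    then show "norm (deriv g (X\<^sub>0 t) * vector_derivative X\<^sub>0 (at t within {a..b})) = \<bar>Re (G' t)\<bar>"
      by (simp only: G'_def)
  qed
  ultimately have "weighted_length (\<lambda>z. norm (gradient p z)) a b X\<^sub>0 = \<bar>h b - h a\<bar>"
    by simp
  also have "\<bar>h b - h a\<bar> = norm (g z\<^sub>2 - g z\<^sub>1)"
    using real[of a] real[of b] X0 by (simp flip: of_real_diff)
  also have "\<dots> \<le> weighted_length (\<lambda>z. norm (gradient p z)) c d X"
    unfolding length[OF assms(11)] using X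
      norm_diff_le_integral_norm_deriv[OF _
        holomorphic_image_of_C1_curve[OF g \<open>open \<Omega>\<close> assms(10,11)]] by simp
  finally show ?thesis .
qed

end
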